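(* The parameterized problem Stable Cutset[vc] admits a polynomial kernelization to equivalent instances with $\mathcal{O}(|X|^3)$ vertices. That is, there is an algorithm running in time polynomial in the input size which, given a graph $G$ and a vertex cover $X$ of $G$, outputs a graph $G'$ and a vertex cover $X'$ of $G'$ such that $G'$ has a stable cutset if and only if $G$ has a stable cutset, and $|V(G')|\le c\cdot |X|^3$ for some absolute constant $c$.
   Context: All graphs are finite and simple. A stable cutset of a graph $G$ is a set $S\subseteq V(G)$ whose vertices are pairwise non-adjacent and such that $G-S$ is disconnected (has at least two connected components); the empty set is a stable cutset of any disconnected graph. A vertex cover of $G$ is a set $X\subseteq V(G)$ such that $V(G)\setminus X$ is a stable set. Stable Cutset[vc]: input is a graph $G$ and a vertex cover $X$ of $G$; the parameter is $|X|$; the question is whether $G$ has a stable cutset. A kernelization may alternatively output a constant-size yes- or no-instance. *)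

theory Defs
  imports
    "Graph_Theory.Graph_Theory"
    "HOL-Computational_Algebra.Polynomial"
begin

section \<open>Stable cutsets and vertex covers\<close>

text \<open>
  A finite simple graph is a \<^term>\<open>pair_graph\<close>: finitely many vertices, a symmetric set of arcs
  without loops.  The edge \<open>{u, v}\<close> is the pair of arcs \<open>(u, v)\<close>, \<open>(v, u)\<close>, and the strongly
  connected components of such a graph are its connected components.
\<close>

definition stable_set :: "'a pair_pre_digraph \<Rightarrow> 'a set \<Rightarrow> bool" where
  "stable_set G S \<longleftrightarrow> S \<subseteq> pverts G \<and> (\<forall>u\<in>S. \<forall>v\<in>S. (u, v) \<notin> parcs G)"

text \<open>
  \<open>\<not> connected (G - S)\<close> would not do here: the library counts the graph without vertices as not
  connected, but it does not have two components.
\<close>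

definition stable_cutset :: "'a pair_pre_digraph \<Rightarrow> 'a set \<Rightarrow> bool" where
  "stable_cutset G S \<longleftrightarrow>
     stable_set G S \<and> 2 \<le> card (pre_digraph.sccs (with_proj G \<restriction> (pverts G - S)))"

definition has_stable_cutset :: "'a pair_pre_digraph \<Rightarrow> bool" where
  "has_stable_cutset G \<longleftrightarrow> (\<exists>S. stable_cutset G S)"

definition vertex_cover :: "'a pair_pre_digraph \<Rightarrow> 'a set \<Rightarrow> bool" where
  "vertex_cover G X \<longleftrightarrow> X \<subseteq> pverts G \<and> stable_set G (pverts G - X)"

section \<open>Model of computation\<close>

text \<open>
  Algorithms are programs of Jones's WHILE language, whose data are binary trees.  A program has
  finitely many variables and the operations cons, head, tail and equality test.
\<close>

datatype data = Nil | Cons data data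

fun data_size :: "data \<Rightarrow> nat" where
  "data_size Nil = 1"
| "data_size (Cons a b) = Suc (data_size a + data_size b)"

fun data_hd :: "data \<Rightarrow> data" where
  "data_hd Nil = Nil"
| "data_hd (Cons a b) = a"

fun data_tl :: "data \<Rightarrow> data" where
  "data_tl Nil = Nil"
| "data_tl (Cons a b) = b"

hide_const (open) Nil Cons

type_synonym store = "nat \<Rightarrow> data"

datatype expr =
    EVar nat
  | ENil
  | ECons expr expr
  | EHd expr
  | ETl expr
  | EEq expr expr

fun eval_expr :: "expr \<Rightarrow> store \<Rightarrow> data" where
  "eval_expr (EVar x) s = s x"
| "eval_expr ENil s = data.Nil"
| "eval_expr (ECons a b) s = data.Cons (eval_expr a s) (eval_expr b s)"
| "eval_expr (EHd a) s = data_hd (eval_expr a s)"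
| "eval_expr (ETl a) s = data_tl (eval_expr a s)"
| "eval_expr (EEq a b) s =
     (if eval_expr a s = eval_expr b s then data.Cons data.Nil data.Nil else data.Nil)"

text \<open>
  Every evaluation of a subexpression is charged with the size of its value, that is, with the
  cost of copying it.  With unit costs, repeating \<open>x := cons x x\<close> would build a value of
  exponential size in linear time; with these costs the size of every value is bounded by the
  running time, and running times agree with those of Turing machines up to a polynomial.
\<close>

fun expr_time :: "expr \<Rightarrow> store \<Rightarrow> nat" where
  "expr_time (EVar x) s = data_size (s x)"
| "expr_time ENil s = 1"
| "expr_time (ECons a b) s =
     expr_time a s + expr_time b s + data_size (eval_expr (ECons a b) s)"
| "expr_time (EHd a) s = expr_time a s + data_size (eval_expr (EHd a) s)"
| "expr_time (ETl a) s = expr_time a s + data_size (eval_expr (ETl a) s)"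
| "expr_time (EEq a b) s =
     expr_time a s + expr_time b s + data_size (eval_expr (EEq a b) s)"

datatype com =
    Skip
  | Assign nat expr
  | Seq com com
  | If expr com com
  | While expr com

text \<open>
  \<open>exec c s t s'\<close>: started in store \<open>s\<close>, the program \<open>c\<close> terminates after time \<open>t\<close> in store \<open>s'\<close>.
  A test succeeds if its value is not nil.
\<close>

inductive exec :: "com \<Rightarrow> store \<Rightarrow> nat \<Rightarrow> store \<Rightarrow> bool" where
  exec_Skip: "exec Skip s 1 s"
| exec_Assign: "exec (Assign x e) s (Suc (expr_time e s)) (s(x := eval_expr e s))"
| exec_Seq: "exec c1 s t1 s1 \<Longrightarrow> exec c2 s1 t2 s2 \<Longrightarrow> exec (Seq c1 c2) s (t1 + t2) s2"
| exec_IfTrue: "eval_expr e s \<noteq> data.Nil \<Longrightarrow> exec c1 s t s' \<Longrightarrow>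
     exec (If e c1 c2) s (Suc (expr_time e s + t)) s'"
| exec_IfFalse: "eval_expr e s = data.Nil \<Longrightarrow> exec c2 s t s' \<Longrightarrow>
     exec (If e c1 c2) s (Suc (expr_time e s + t)) s'"
| exec_WhileFalse: "eval_expr e s = data.Nil \<Longrightarrow>
     exec (While e c) s (Suc (expr_time e s)) s"
| exec_WhileTrue: "eval_expr e s \<noteq> data.Nil \<Longrightarrow> exec c s t1 s1 \<Longrightarrow>
     exec (While e c) s1 t2 s2 \<Longrightarrow>
     exec (While e c) s (Suc (expr_time e s + t1 + t2)) s2"

text \<open>Variable \<open>0\<close> holds the input and the output; the other variables are initially nil.\<close>

definition computes :: "com \<Rightarrow> data \<Rightarrow> nat \<Rightarrow> data \<Rightarrow> bool" where
  "computes c w t w' \<longleftrightarrow> (\<exists>s. exec c ((\<lambda>_. data.Nil)(0 := w)) t s \<and> s 0 = w')"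

lemma exec_deterministic:
  "exec c s t s' \<Longrightarrow> exec c s u s'' \<Longrightarrow> t = u \<and> s' = s''"
proof (induction arbitrary: u s'' rule: exec.induct)
  case exec_Skip
  then show ?case by (auto elim: exec.cases)
next
  case exec_Assign
  then show ?case by (auto elim: exec.cases)
next
  case (exec_Seq c1 s t1 s1 c2 t2 s2)
  from exec_Seq.prems show ?case
    by (cases rule: exec.cases) (use exec_Seq.IH in blast)
next
  case (exec_IfTrue e s c1 t s' c2)
  from exec_IfTrue.prems show ?case
    by (cases rule: exec.cases) (use exec_IfTrue in blast)+
next
  case (exec_IfFalse e s c2 t s' c1)
  from exec_IfFalse.prems show ?case
    by (cases rule: exec.cases) (use exec_IfFalse in blast)+
next
  case (exec_WhileFalse e s c)
  from exec_WhileFalse.prems show ?case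
    by (cases rule: exec.cases) (use exec_WhileFalse in blast)+
next
  case (exec_WhileTrue e s c t1 s1 t2 s2)
  from exec_WhileTrue.prems show ?case
    by (cases rule: exec.cases) (use exec_WhileTrue in blast)+
qed

section \<open>Encoding of instances\<close>

fun encode_list :: "('a \<Rightarrow> data) \<Rightarrow> 'a list \<Rightarrow> data" where
  "encode_list f [] = data.Nil"
| "encode_list f (x # xs) = data.Cons (f x) (encode_list f xs)"

definition encode_bool :: "bool \<Rightarrow> data" where
  "encode_bool b = (if b then data.Cons data.Nil data.Nil else data.Nil)"

text \<open>Vertex names are written in binary, least significant bit first.\<close>

fun bits :: "nat \<Rightarrow> bool list" where
  "bits n = (if n = 0 then [] else odd n # bits (n div 2))"

declare bits.simps [simp del]

definition encode_nat :: "nat \<Rightarrow> data" where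
  "encode_nat n = encode_list encode_bool (bits n)"

definition encode_edge :: "nat \<times> nat \<Rightarrow> data" where
  "encode_edge e = data.Cons (encode_nat (fst e)) (encode_nat (snd e))"

text \<open>
  An instance \<open>(G, X)\<close> is given by a list of the vertices of \<open>G\<close>, a list of its edges and a list of
  the elements of \<open>X\<close>, in any order and without repetitions; each edge occurs in one of its two
  orientations.
\<close>

definition encodes_instance :: "data \<Rightarrow> nat pair_pre_digraph \<Rightarrow> nat set \<Rightarrow> bool" where
  "encodes_instance w G X \<longleftrightarrow>
     (\<exists>vs es xs.
        w = data.Cons (encode_list encode_nat vs)
              (data.Cons (encode_list encode_edge es) (encode_list encode_nat xs)) \<and>
        distinct vs \<and> set vs = pverts G \<and>
        distinct (map (\<lambda>(u, v). {u, v}) es) \<and> set es \<union> (set es)\<inverse> = parcs G \<and>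
        distinct xs \<and> set xs = X)"

lemma inj_encode_list: "inj f \<Longrightarrow> inj (encode_list f)"
proof (rule injI)
  fix xs ys assume "inj f" and "encode_list f xs = encode_list f ys"
  then show "xs = ys"
  proof (induction xs arbitrary: ys)
    case Nil
    then show ?case by (cases ys) auto
  next
    case (Cons x xs)
    then show ?case by (cases ys) (auto dest: injD)
  qed
qed

lemma inj_bits: "inj bits"
proof (rule injI)
  fix m n show "bits m = bits n \<Longrightarrow> m = n"
  proof (induction m arbitrary: n rule: less_induct)
    case (less m)
    show ?case
    proof (cases "m = 0 \<or> n = 0")
      case True
      with less.prems show ?thesis by (auto simp: bits.simps[of m] bits.simps[of n] split: if_splits)
    next
      case False
      with less.prems have "odd m = odd n" "bits (m div 2) = bits (n div 2)"
        by (auto simp: bits.simps[of m] bits.simps[of n])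
      with less.IH[of "m div 2" "n div 2"] False have "m div 2 = n div 2" by simp
      with \<open>odd m = odd n\<close> show ?thesis by presburger
    qed
  qed
qed

lemma inj_encode_nat: "inj encode_nat"
proof -
  have "inj encode_bool" by (auto intro!: injI simp: encode_bool_def split: if_splits)
  then have "inj (encode_list encode_bool \<circ> bits)"
    by (intro inj_compose inj_encode_list inj_bits)
  then show ?thesis by (simp add: encode_nat_def[abs_def] comp_def)
qed

lemma inj_encode_edge: "inj encode_edge"
  by (auto intro!: injI simp: encode_edge_def dest: injD[OF inj_encode_nat])

lemma encodes_instance_unique:
  assumes "encodes_instance w G X" "encodes_instance w H Y"
  shows "pverts G = pverts H" "parcs G = parcs H" "X = Y"
  using assms unfolding encodes_instance_def
  by (auto dest!: injD[OF inj_encode_list[OF inj_encode_nat]]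
      injD[OF inj_encode_list[OF inj_encode_edge]])

end

theory Submission
  imports Defs
begin

text \<open>
  Let \<open>v\<close> be a vertex outside \<open>X\<close>.  If its neighbourhood is stable and \<open>G\<close> has at least three vertices,
  then the neighbourhood, or \<open>{v}\<close> if \<open>G\<close> is a star with centre \<open>v\<close>, is a stable cutset.  Otherwise
  every vertex outside \<open>X\<close> lies in a triangle with two vertices of \<open>X\<close>.  Then both sides of a
  separation \<open>(A, S, B)\<close> by a stable set \<open>S\<close> meet \<open>X\<close>, and a separation of \<open>X\<close> extends to \<open>G\<close> if and only
  if no outside vertex has neighbours in all three parts.  This condition only concerns triples
  of \<open>X\<close>, so it suffices to keep, for every triple, one common neighbour outside \<open>X\<close>.
\<close>

section \<open>Polynomial-time functions on binary trees\<close>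

text \<open>Natural coefficients make the bounding polynomials monotone, so bounds can be added,
  multiplied and composed without side conditions.\<close>

definition polybound :: "(data \<Rightarrow> nat) \<Rightarrow> bool" where
  "polybound g \<longleftrightarrow> (\<exists>p :: nat poly. \<forall>w. g w \<le> poly p (data_size w))"

text \<open>
  The program \<open>c\<close> assigns \<open>f x\<close> to the variable \<open>y\<close>; apart from \<open>y\<close> it may only overwrite the
  variables from \<open>n\<close> on, whose initial contents are arbitrary.
\<close>

definition implements :: "com \<Rightarrow> nat \<Rightarrow> nat \<Rightarrow> nat \<Rightarrow> (data \<Rightarrow> data) \<Rightarrow> (data \<Rightarrow> nat) \<Rightarrow> bool" where
  "implements c x y n f T \<longleftrightarrow> (\<forall>s. \<exists>t s'. exec c s t s' \<and> t \<le> T (s x) \<and>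
     s' y = f (s x) \<and> (\<forall>z<n. z \<noteq> y \<longrightarrow> s' z = s z))"

text \<open>The size bound keeps the cost of later operations on the result polynomial in the input.
  Programs are demanded for all \<open>x\<close>, \<open>y\<close> and \<open>n\<close>, so that
  components can be placed on disjoint scratch variables when they are combined.\<close>

definition polytime :: "(data \<Rightarrow> data) \<Rightarrow> bool" where
  "polytime f \<longleftrightarrow> polybound (\<lambda>w. data_size (f w)) \<and>
     (\<forall>x y n. x < n \<longrightarrow> y < n \<longrightarrow> (\<exists>c T. polybound T \<and> implements c x y n f T))"

abbreviation polytime_pred :: "(data \<Rightarrow> bool) \<Rightarrow> bool" where
  "polytime_pred P \<equiv> polytime (\<lambda>w. encode_bool (P w))"

section \<open>Arithmetic of polynomial bounds\<close>

lemma poly_nat_mono: "m \<le> n \<Longrightarrow> poly p m \<le> poly (p :: nat poly) n"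
  by (induction p) (auto intro!: add_mono mult_mono)

lemma polybound_le: "polybound g \<Longrightarrow> (\<And>w. f w \<le> g w) \<Longrightarrow> polybound f"
  unfolding polybound_def by (meson order_trans)

lemma polybound_const: "polybound (\<lambda>_. k)"
  unfolding polybound_def by (rule exI[of _ "[:k:]"]) simp

lemma polybound_size: "polybound data_size"
  unfolding polybound_def by (rule exI[of _ "[:0, 1:]"]) simp

lemma polybound_add: "polybound f \<Longrightarrow> polybound g \<Longrightarrow> polybound (\<lambda>w. f w + g w)"
  unfolding polybound_def by (metis add_mono poly_add)

lemma polybound_mult: "polybound f \<Longrightarrow> polybound g \<Longrightarrow> polybound (\<lambda>w. f w * g w)"
  unfolding polybound_def by (metis mult_le_mono poly_mult)

lemma polybound_Suc: "polybound f \<Longrightarrow> polybound (\<lambda>w. Suc (f w))"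
  using polybound_add[OF polybound_const[of 1], of f] by simp

text \<open>Composition of polynomials, by monotonicity of the outer one. It serves subprograms that
  run on an intermediate value whose size is itself only polynomially bounded.\<close>

lemma polybound_poly: "polybound f \<Longrightarrow> polybound (\<lambda>w. poly p (f w))"
  unfolding polybound_def
proof (elim exE)
  fix q :: "nat poly" assume q: "\<forall>w. f w \<le> poly q (data_size w)"
  show "\<exists>r. \<forall>w. poly p (f w) \<le> poly r (data_size w)"
    using q by (intro exI[of _ "pcompose p q"]) (auto simp: poly_pcompose intro: poly_nat_mono)
qed

lemmas polybound_intros = polybound_const polybound_size polybound_add polybound_mult polybound_Suc
  polybound_poly

lemma data_size_hd_le: "data_size (data_hd d) \<le> data_size d"
  by (cases d) auto

lemma data_size_tl_le: "data_size (data_tl d) \<le> data_size d"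
  by (cases d) auto

lemma data_size_encode_bool_le: "data_size (encode_bool b) \<le> 3"
  by (simp add: encode_bool_def)

lemma encode_bool_eq_Nil_iff: "encode_bool b = data.Nil \<longleftrightarrow> \<not> b"
  by (simp add: encode_bool_def)

lemma polytime_size: "polytime f \<Longrightarrow> polybound (\<lambda>w. data_size (f w))"
  by (simp add: polytime_def)

lemma polytime_implements:
  assumes "polytime f" "x < n" "y < n"
  obtains c T where "polybound T" "implements c x y n f T"
  using assms unfolding polytime_def by blast

lemma implementsE:
  assumes "implements c x y n f T"
  obtains t s' where "exec c s t s'" "t \<le> T (s x)" "s' y = f (s x)"
    "\<And>z. z < n \<Longrightarrow> z \<noteq> y \<Longrightarrow> s' z = s z"
  using assms unfolding implements_def by meson

section \<open>Expressions and branching\<close>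

lemma polytime_id: "polytime (\<lambda>w. w)"
proof -
  have "implements (Assign y (EVar x)) x y n (\<lambda>w. w) (\<lambda>w. Suc (data_size w))" for x y n
    unfolding implements_def
  proof
    fix s
    show "\<exists>t s'. exec (Assign y (EVar x)) s t s' \<and> t \<le> Suc (data_size (s x)) \<and> s' y = s x \<and>
      (\<forall>z<n. z \<noteq> y \<longrightarrow> s' z = s z)"
      using exec_Assign[of y "EVar x" s] by (intro exI[of _ "Suc (data_size (s x))"] exI[of _ "s(y := s x)"]) simp
  qed
  then show ?thesis unfolding polytime_def
    using polybound_size polybound_Suc[OF polybound_size] by blast
qed

text \<open>One scheme for all operations of the language: compute \<open>f\<close> and
  \<open>g\<close> into fresh variables and evaluate a single expression on them. For unary and
  nullary operations \<open>h\<close> is constant in some of its arguments.\<close>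

lemma polytime_expr2:
  assumes f: "polytime f" and g: "polytime g"
    and h: "\<And>u v s. eval_expr (e u v) s = h (s u) (s v)"
    and t: "\<And>u v s. expr_time (e u v) s \<le> k * (data_size (s u) + data_size (s v)) + k"
    and sz: "\<And>a b. data_size (h a b) \<le> data_size a + data_size b + k"
  shows "polytime (\<lambda>w. h (f w) (g w))"
  unfolding polytime_def
proof (intro conjI allI impI)
  note pf = polytime_size[OF f] and pg = polytime_size[OF g]
  show "polybound (\<lambda>w. data_size (h (f w) (g w)))"
    by (rule polybound_le[OF _ sz]) (intro polybound_intros pf pg)
  fix x y n :: nat assume xy: "x < n" "y < n"
  obtain cf Tf where cf: "polybound Tf" "implements cf x n (n + 2) f Tf"
    using xy by (auto intro: polytime_implements[OF f, of x "n + 2" n])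
  \<comment> \<open>Scratch space starting at \<open>n + 2\<close> keeps the second program from
    overwriting the input \<open>x\<close> and the value of \<open>f\<close> in
    \<open>n\<close>.\<close>
  obtain cg Tg where cg: "polybound Tg" "implements cg x (n + 1) (n + 2) g Tg"
    using xy by (auto intro: polytime_implements[OF g, of x "n + 2" "n + 1"])
  let ?e = "e n (n + 1)"
  let ?T = "\<lambda>w. Tf w + (Tg w + Suc (k * (data_size (f w) + data_size (g w)) + k))"
  have "implements (Seq cf (Seq cg (Assign y ?e))) x y n (\<lambda>w. h (f w) (g w)) ?T"
    unfolding implements_def
  proof
    fix s
    obtain t1 s1 where 1: "exec cf s t1 s1" "t1 \<le> Tf (s x)" "s1 n = f (s x)"
      "\<And>z. z < n + 2 \<Longrightarrow> z \<noteq> n \<Longrightarrow> s1 z = s z"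
      using cf(2) by (rule implementsE[where s = s]) blast
    obtain t2 s2 where 2: "exec cg s1 t2 s2" "t2 \<le> Tg (s1 x)" "s2 (n + 1) = g (s1 x)"
      "\<And>z. z < n + 2 \<Longrightarrow> z \<noteq> n + 1 \<Longrightarrow> s2 z = s1 z"
      using cg(2) by (rule implementsE[where s = s1]) blast
    have x: "s1 x = s x" using 1(4)[of x] xy by simp
    have n: "s2 n = f (s x)" using 2(4)[of n] 1(3) by simp
    have n1: "s2 (n + 1) = g (s x)" using 2(3) x by simp
    have "exec (Seq cf (Seq cg (Assign y ?e))) s (t1 + (t2 + Suc (expr_time ?e s2)))
      (s2(y := eval_expr ?e s2))"
      by (rule exec_Seq[OF 1(1) exec_Seq[OF 2(1) exec_Assign]])
    moreover have "t1 + (t2 + Suc (expr_time ?e s2)) \<le> ?T (s x)"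
      using 1(2) 2(2) t[of n "n + 1" s2] unfolding x n n1 by linarith
    moreover have "\<forall>z<n. z \<noteq> y \<longrightarrow> (s2(y := eval_expr ?e s2)) z = s z"
      using 1(4) 2(4) by simp
    moreover have "(s2(y := eval_expr ?e s2)) y = h (f (s x)) (g (s x))"
      using n n1 h by simp
    ultimately show "\<exists>t s'. exec (Seq cf (Seq cg (Assign y ?e))) s t s' \<and> t \<le> ?T (s x) \<and>
      s' y = h (f (s x)) (g (s x)) \<and> (\<forall>z<n. z \<noteq> y \<longrightarrow> s' z = s z)"
      by blast
  qed
  moreover have "polybound ?T" by (intro polybound_intros pf pg cf(1) cg(1))
  ultimately show "\<exists>c T. polybound T \<and> implements c x y n (\<lambda>w. h (f w) (g w)) T" by blast
qed

lemma polytime_Nil: "polytime (\<lambda>_. data.Nil)"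
  using polytime_expr2[OF polytime_id polytime_id,
      where e = "\<lambda>_ _. ENil" and h = "\<lambda>_ _. data.Nil" and k = 1] by simp

lemma polytime_Cons: "polytime f \<Longrightarrow> polytime g \<Longrightarrow> polytime (\<lambda>w. data.Cons (f w) (g w))"
  by (rule polytime_expr2[where e = "\<lambda>u v. ECons (EVar u) (EVar v)" and h = data.Cons and k = 2])
    auto

lemma polytime_hd: "polytime f \<Longrightarrow> polytime (\<lambda>w. data_hd (f w))"
  by (rule polytime_expr2[where g = f and e = "\<lambda>u v. EHd (EVar u)" and h = "\<lambda>a _. data_hd a" and k = 2])
    (auto intro: order_trans[OF data_size_hd_le])

lemma polytime_tl: "polytime f \<Longrightarrow> polytime (\<lambda>w. data_tl (f w))"
  by (rule polytime_expr2[where g = f and e = "\<lambda>u v. ETl (EVar u)" and h = "\<lambda>a _. data_tl a" and k = 2])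
    (auto intro: order_trans[OF data_size_tl_le])

lemma polytime_eq: "polytime f \<Longrightarrow> polytime g \<Longrightarrow> polytime_pred (\<lambda>w. f w = g w)"
  by (rule polytime_expr2[where e = "\<lambda>u v. EEq (EVar u) (EVar v)"
        and h = "\<lambda>a b. encode_bool (a = b)" and k = 3])
    (auto simp: encode_bool_def)

lemma polytime_const: "polytime (\<lambda>_. d)"
  by (induction d) (auto intro: polytime_Nil polytime_Cons)

lemma polytime_if:
  assumes P: "polytime_pred P" and f: "polytime f" and g: "polytime g"
  shows "polytime (\<lambda>w. if P w then f w else g w)"
  unfolding polytime_def
proof (intro conjI allI impI)
  note pf = polytime_size[OF f] and pg = polytime_size[OF g]
  show "polybound (\<lambda>w. data_size (if P w then f w else g w))"
    by (rule polybound_le[OF polybound_add[OF pf pg]]) simp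
  fix x y n :: nat assume xy: "x < n" "y < n"
  obtain cp Tp where cp: "polybound Tp" "implements cp x n (n + 1) (\<lambda>w. encode_bool (P w)) Tp"
    using xy by (auto intro: polytime_implements[OF P, of x "n + 1" n])
  obtain cf Tf where cf: "polybound Tf" "implements cf x y n f Tf"
    using xy by (rule polytime_implements[OF f])
  obtain cg Tg where cg: "polybound Tg" "implements cg x y n g Tg"
    using xy by (rule polytime_implements[OF g])
  let ?c = "Seq cp (If (EVar n) cf cg)"
  \<comment> \<open>An encoded truth value has size at most 3, which bounds the cost of the test.
    Charging both branches makes one bound valid in either case.\<close>
  let ?T = "\<lambda>w. Tp w + Suc (3 + (Tf w + Tg w))"
  have "implements ?c x y n (\<lambda>w. if P w then f w else g w) ?T"
    unfolding implements_def
  proof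
    fix s
    obtain t1 s1 where 1: "exec cp s t1 s1" "t1 \<le> Tp (s x)" "s1 n = encode_bool (P (s x))"
      "\<And>z. z < n + 1 \<Longrightarrow> z \<noteq> n \<Longrightarrow> s1 z = s z"
      using cp(2) by (rule implementsE[where s = s]) blast
    obtain t2 s2 where 2: "exec cf s1 t2 s2" "t2 \<le> Tf (s1 x)" "s2 y = f (s1 x)"
      "\<And>z. z < n \<Longrightarrow> z \<noteq> y \<Longrightarrow> s2 z = s1 z"
      using cf(2) by (rule implementsE[where s = s1]) blast
    obtain t3 s3 where 3: "exec cg s1 t3 s3" "t3 \<le> Tg (s1 x)" "s3 y = g (s1 x)"
      "\<And>z. z < n \<Longrightarrow> z \<noteq> y \<Longrightarrow> s3 z = s1 z"
      using cg(2) by (rule implementsE[where s = s1]) blast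
    have x: "s1 x = s x" using 1(4)[of x] xy by simp
    have sz: "data_size (s1 n) \<le> 3" using data_size_encode_bool_le by (simp add: 1(3))
    show "\<exists>t s'. exec ?c s t s' \<and> t \<le> ?T (s x) \<and>
      s' y = (if P (s x) then f (s x) else g (s x)) \<and> (\<forall>z<n. z \<noteq> y \<longrightarrow> s' z = s z)"
    proof (cases "P (s x)")
      case True
      then have "exec ?c s (t1 + Suc (expr_time (EVar n) s1 + t2)) s2"
        by (intro exec_Seq[OF 1(1) exec_IfTrue[OF _ 2(1)]]) (simp add: 1(3) encode_bool_eq_Nil_iff)
      moreover have "t1 + Suc (expr_time (EVar n) s1 + t2) \<le> ?T (s x)"
        using 1(2) 2(2) x sz by simp
      moreover have "\<forall>z<n. z \<noteq> y \<longrightarrow> s2 z = s z" using 1(4) 2(4) by simp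
      ultimately show ?thesis using True 2(3) x by metis
    next
      case False
      then have "exec ?c s (t1 + Suc (expr_time (EVar n) s1 + t3)) s3"
        by (intro exec_Seq[OF 1(1) exec_IfFalse[OF _ 3(1)]]) (simp add: 1(3) encode_bool_eq_Nil_iff)
      moreover have "t1 + Suc (expr_time (EVar n) s1 + t3) \<le> ?T (s x)"
        using 1(2) 3(2) x sz by simp
      moreover have "\<forall>z<n. z \<noteq> y \<longrightarrow> s3 z = s z" using 1(4) 3(4) by simp
      ultimately show ?thesis using False 3(3) x by metis
    qed
  qed
  moreover have "polybound ?T" by (intro polybound_intros cp(1) cf(1) cg(1))
  ultimately show "\<exists>c T. polybound T \<and> implements c x y n (\<lambda>w. if P w then f w else g w) T"
    by blast
qed

lemma polytime_pred_if:
  assumes "polytime_pred P" "polytime_pred Q" "polytime_pred R"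
  shows "polytime_pred (\<lambda>w. if P w then Q w else R w)"
  using polytime_if[OF assms] by (simp add: if_distrib)

lemma polytime_True: "polytime_pred (\<lambda>_. True)"
  and polytime_False: "polytime_pred (\<lambda>_. False)"
  by (rule polytime_const)+

lemma polytime_not: "polytime_pred P \<Longrightarrow> polytime_pred (\<lambda>w. \<not> P w)"
  using polytime_pred_if[OF _ polytime_False polytime_True, of P] by (simp add: if_bool_eq_conj)

lemma polytime_conj: "polytime_pred P \<Longrightarrow> polytime_pred Q \<Longrightarrow> polytime_pred (\<lambda>w. P w \<and> Q w)"
  using polytime_pred_if[OF _ _ polytime_False, of P Q] by (simp add: if_bool_eq_disj)

lemma polytime_disj: "polytime_pred P \<Longrightarrow> polytime_pred Q \<Longrightarrow> polytime_pred (\<lambda>w. P w \<or> Q w)"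
  using polytime_pred_if[OF _ polytime_True, of P Q] by (simp add: if_bool_eq_conj disj_imp)

section \<open>Filtering and searching lists\<close>

fun data_elems :: "data \<Rightarrow> data set" where
  "data_elems data.Nil = {}"
| "data_elems (data.Cons a b) = insert a (data_elems b)"

text \<open>The selected elements come out in reverse order, in front of the accumulator.\<close>

fun data_filter :: "(data \<Rightarrow> bool) \<Rightarrow> data \<Rightarrow> data \<Rightarrow> data" where
  "data_filter P data.Nil acc = acc"
| "data_filter P (data.Cons a b) acc = data_filter P b (if P a then data.Cons a acc else acc)"

lemma data_size_filter_le: "data_size (data_filter P l acc) \<le> data_size l + data_size acc"
proof (induction l arbitrary: acc)
  case (Cons a b)
  then show ?case using Cons.IH(2)[of "data.Cons a acc"] le_trans[OF Cons.IH(2)[of acc]] by auto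
qed simp

text \<open>A predicate with a parameter is evaluated on the pair of its argument and the parameter.\<close>

lemma polytime_filter:
  assumes P: "polytime_pred (\<lambda>v. P (data_hd v) (data_tl v))" and l: "polytime l"
  shows "polytime (\<lambda>w. data_filter (\<lambda>e. P e w) (l w) data.Nil)"
  unfolding polytime_def
proof (intro conjI allI impI)
  note pl = polytime_size[OF l]
  show "polybound (\<lambda>w. data_size (data_filter (\<lambda>e. P e w) (l w) data.Nil))"
    by (rule polybound_le[OF _ data_size_filter_le]) (intro polybound_intros pl)
  fix x y n :: nat assume xy: "x < n" "y < n"
  \<comment> \<open>\<open>n\<close> holds the remaining list, \<open>n + 1\<close> the pair of the
    current element and the input, \<open>n + 2\<close> the truth value of the predicate and
    \<open>n + 3\<close> the accumulator.\<close>
  obtain cl Tl where cl: "polybound Tl" "implements cl x n (n + 4) l Tl"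
    using xy by (auto intro: polytime_implements[OF l, of x "n + 4" n])
  obtain cp Tp where cp: "polybound Tp"
    "implements cp (n + 1) (n + 2) (n + 4) (\<lambda>v. encode_bool (P (data_hd v) (data_tl v))) Tp"
    by (auto intro: polytime_implements[OF P, of "n + 1" "n + 4" "n + 2"])
  \<comment> \<open>The predicate runs on a different pair in each round. Unlike \<open>Tp\<close>,
    a polynomial in the size is monotone and gives one bound for all of them.\<close>
  obtain p where p: "\<And>v. Tp v \<le> poly p (data_size v)" using cp(1) by (auto simp: polybound_def)
  let ?acc = "Assign (n + 3) (ECons (EHd (EVar n)) (EVar (n + 3)))"
  let ?body = "Seq (Assign (n + 1) (ECons (EHd (EVar n)) (EVar x)))
    (Seq cp (Seq (If (EVar (n + 2)) ?acc Skip) (Assign n (ETl (EVar n)))))"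
  let ?loop = "While (EVar n) ?body"
  \<comment> \<open>A bound on one round: 20 is a generous factor for the assignments and tests, and
    \<open>poly p\<close> pays for the predicate on a pair of size at most
    \<open>Suc (K + data_size w)\<close>.\<close>
  let ?B = "\<lambda>K w. 20 * Suc (K + data_size w) + poly p (Suc (K + data_size w))"
  \<comment> \<open>\<open>K\<close> bounds the remaining list and the accumulator together. One
    multiple of \<open>?B\<close> per unit of \<open>data_size d\<close> pays for all rounds; the
    size 1 of nil pays for the final failing test.\<close>
  have loop: "\<exists>t s'. exec ?loop s t s' \<and> t \<le> data_size d * ?B K (s x) \<and>
      s' (n + 3) = data_filter (\<lambda>e. P e (s x)) d (s (n + 3)) \<and> (\<forall>z<n. s' z = s z)"
    if "s n = d" "data_size d + data_size (s (n + 3)) \<le> K" for d K s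
    using that
  proof (induction d arbitrary: s)
    case Nil
    then have "exec ?loop s (Suc (expr_time (EVar n) s)) s"
      by (intro exec_WhileFalse) simp
    then show ?case using Nil
      by (intro exI[of _ "Suc (expr_time (EVar n) s)"] exI[of _ s]) simp
  next
    case (Cons a b)
    let ?w = "s x" and ?r = "s (n + 3)"
    define s1 where "s1 = s(n + 1 := data.Cons a ?w)"
    let ?t1 = "Suc (expr_time (ECons (EHd (EVar n)) (EVar x)) s)"
    have e1: "exec (Assign (n + 1) (ECons (EHd (EVar n)) (EVar x))) s ?t1 s1"
      using exec_Assign[of "n + 1" "ECons (EHd (EVar n)) (EVar x)" s] Cons.prems(1)
      by (simp add: s1_def)
    obtain t2 s2 where 2: "exec cp s1 t2 s2" "t2 \<le> Tp (s1 (n + 1))"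
      "s2 (n + 2) = encode_bool (P (data_hd (s1 (n + 1))) (data_tl (s1 (n + 1))))"
      "\<And>z. z < n + 4 \<Longrightarrow> z \<noteq> n + 2 \<Longrightarrow> s2 z = s1 z"
      using cp(2) by (rule implementsE[where s = s1]) blast
    have s2: "s2 (n + 2) = encode_bool (P a ?w)" "s2 n = data.Cons a b" "s2 (n + 3) = ?r"
      "\<And>z. z < n \<Longrightarrow> s2 z = s z"
      using 2(3,4) Cons.prems(1) by (auto simp: s1_def)
    have "Tp (s1 (n + 1)) \<le> poly p (data_size (data.Cons a ?w))" using p[of "data.Cons a ?w"] by (simp add: s1_def)
    also have "\<dots> \<le> poly p (Suc (K + data_size ?w))"
      using Cons.prems(2) by (intro poly_nat_mono) simp
    finally have t2: "t2 \<le> poly p (Suc (K + data_size ?w))" using 2(2) by simp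
    define r where "r = (if P a ?w then data.Cons a ?r else ?r)"
    define s3 where "s3 = s2(n + 3 := r)"
    have "\<exists>t3. exec (If (EVar (n + 2)) ?acc Skip) s2 t3 s3 \<and> t3 \<le> 9 + 3 * K"
    proof (cases "P a ?w")
      case True
      have "exec (If (EVar (n + 2)) ?acc Skip) s2
        (Suc (expr_time (EVar (n + 2)) s2 + Suc (expr_time (ECons (EHd (EVar n)) (EVar (n + 3))) s2)))
        (s2(n + 3 := eval_expr (ECons (EHd (EVar n)) (EVar (n + 3))) s2))"
        using s2(1) True by (intro exec_IfTrue exec_Assign) (simp add: encode_bool_eq_Nil_iff)
      moreover have "s2(n + 3 := eval_expr (ECons (EHd (EVar n)) (EVar (n + 3))) s2) = s3"
        using s2 True by (simp add: s3_def r_def)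
      moreover have "Suc (expr_time (EVar (n + 2)) s2 +
          Suc (expr_time (ECons (EHd (EVar n)) (EVar (n + 3))) s2)) \<le> 9 + 3 * K"
        using s2 Cons.prems(2) data_size_encode_bool_le[of "P a ?w"] by simp
      ultimately show ?thesis by metis
    next
      case False
      have "exec (If (EVar (n + 2)) ?acc Skip) s2 (Suc (expr_time (EVar (n + 2)) s2 + 1)) s2"
        using s2(1) False by (intro exec_IfFalse exec_Skip) (simp add: encode_bool_eq_Nil_iff)
      moreover have "s2 = s3"
        using s2 False by (auto simp: s3_def r_def)
      ultimately show ?thesis using s2 False
        by (intro exI[of _ "Suc (expr_time (EVar (n + 2)) s2 + 1)"] conjI) (auto simp: encode_bool_def)
    qed
    then obtain t3 where 3: "exec (If (EVar (n + 2)) ?acc Skip) s2 t3 s3" "t3 \<le> 9 + 3 * K" by blast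
    define s4 where "s4 = s3(n := b)"
    let ?t4 = "Suc (expr_time (ETl (EVar n)) s3)"
    have e4: "exec (Assign n (ETl (EVar n))) s3 ?t4 s4"
      using exec_Assign[of n "ETl (EVar n)" s3] s2 by (simp add: s3_def s4_def)
    have s4: "s4 n = b" "s4 (n + 3) = r" "s4 x = ?w" "\<And>z. z < n \<Longrightarrow> s4 z = s z"
      using s2 xy by (auto simp: s3_def s4_def)
    \<comment> \<open>Moving the head from the list to the accumulator keeps the total size and
      dropping it decreases the total, so the same \<open>K\<close> works for the remaining
      rounds.\<close>
    have "data_size b + data_size (s4 (n + 3)) \<le> K"
      using Cons.prems(2) s4(2) by (simp add: r_def)
    from Cons.IH(2)[OF s4(1) this] obtain t5 s5 where 5: "exec ?loop s4 t5 s5"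
      "t5 \<le> data_size b * ?B K ?w" "s5 (n + 3) = data_filter (\<lambda>e. P e ?w) b r"
      "\<And>z. z < n \<Longrightarrow> s5 z = s z"
      using s4 by auto
    let ?t = "Suc (expr_time (EVar n) s + (?t1 + (t2 + (t3 + ?t4))) + t5)"
    have "exec ?loop s ?t s5"
      using Cons.prems(1)
      by (intro exec_WhileTrue[OF _ exec_Seq[OF e1 exec_Seq[OF 2(1) exec_Seq[OF 3(1) e4]]] 5(1)]) simp
    moreover have "?t \<le> data_size (data.Cons a b) * ?B K ?w"
    proof -
      have "expr_time (EVar n) s + ?t1 + t3 + ?t4 + 1 \<le> 20 * Suc (K + data_size ?w)"
        using 3(2) Cons.prems s2 by (simp add: s3_def)
      then have "?t \<le> ?B K ?w + data_size b * ?B K ?w" using t2 5(2) by linarith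
      also have "\<dots> \<le> data_size (data.Cons a b) * ?B K ?w" by (simp add: algebra_simps)
      finally show ?thesis .
    qed
    ultimately show ?case using 5 by (intro exI[of _ ?t] exI[of _ s5]) (auto simp: r_def)
  qed
  let ?c = "Seq cl (Seq (Assign (n + 3) ENil) (Seq ?loop (Assign y (EVar (n + 3)))))"
  \<comment> \<open>The summand 1 is the size of the initially empty accumulator.\<close>
  let ?K = "\<lambda>w. data_size (l w) + 1"
  let ?T = "\<lambda>w. Tl w + (2 + (data_size (l w) * ?B (?K w) w + Suc (?K w)))"
  have "implements ?c x y n (\<lambda>w. data_filter (\<lambda>e. P e w) (l w) data.Nil) ?T"
    unfolding implements_def
  proof
    fix s
    obtain t1 s1 where 1: "exec cl s t1 s1" "t1 \<le> Tl (s x)" "s1 n = l (s x)"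
      "\<And>z. z < n + 4 \<Longrightarrow> z \<noteq> n \<Longrightarrow> s1 z = s z"
      using cl(2) by (rule implementsE[where s = s]) blast
    let ?s2 = "s1(n + 3 := data.Nil)"
    have e2: "exec (Assign (n + 3) ENil) s1 2 ?s2"
      using exec_Assign[of "n + 3" ENil s1] by (simp add: numeral_2_eq_2)
    have x: "?s2 x = s x" using 1(4)[of x] xy by simp
    obtain t3 s3 where 3: "exec ?loop ?s2 t3 s3" "t3 \<le> data_size (l (s x)) * ?B (?K (s x)) (s x)"
      "s3 (n + 3) = data_filter (\<lambda>e. P e (s x)) (l (s x)) data.Nil" "\<And>z. z < n \<Longrightarrow> s3 z = ?s2 z"
      using loop[of ?s2 "l (s x)" "?K (s x)"] 1(3) unfolding x by auto
    have "exec ?c s (t1 + (2 + (t3 + Suc (expr_time (EVar (n + 3)) s3)))) (s3(y := s3 (n + 3)))"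
      using exec_Assign[of y "EVar (n + 3)" s3] by (intro exec_Seq[OF 1(1) exec_Seq[OF e2 exec_Seq[OF 3(1)]]]) simp
    moreover have "t1 + (2 + (t3 + Suc (expr_time (EVar (n + 3)) s3))) \<le> ?T (s x)"
      using 1(2) 3(2,3) data_size_filter_le[of "\<lambda>e. P e (s x)" "l (s x)" data.Nil] by simp
    moreover have "\<forall>z<n. z \<noteq> y \<longrightarrow> (s3(y := s3 (n + 3))) z = s z"
      using 1(4) 3(4) by simp
    ultimately show "\<exists>t s'. exec ?c s t s' \<and> t \<le> ?T (s x) \<and>
      s' y = data_filter (\<lambda>e. P e (s x)) (l (s x)) data.Nil \<and> (\<forall>z<n. z \<noteq> y \<longrightarrow> s' z = s z)"
      using 3(3) by (metis fun_upd_same)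
  qed
  moreover have "polybound ?T" by (intro polybound_intros cl(1) pl)
  ultimately show "\<exists>c T. polybound T \<and>
    implements c x y n (\<lambda>w. data_filter (\<lambda>e. P e w) (l w) data.Nil) T" by blast
qed

lemma data_filter_eq_Nil_iff:
  "data_filter P l acc = data.Nil \<longleftrightarrow> acc = data.Nil \<and> (\<forall>e\<in>data_elems l. \<not> P e)"
  by (induction P l acc rule: data_filter.induct) auto

text \<open>A search succeeds exactly if the corresponding filter returns something other than
  nil.\<close>

lemma polytime_Bex:
  assumes "polytime_pred (\<lambda>v. P (data_hd v) (data_tl v))" "polytime l"
  shows "polytime_pred (\<lambda>w. \<exists>e\<in>data_elems (l w). P e w)"
  using polytime_not[OF polytime_eq[OF polytime_filter[OF assms] polytime_Nil]]
  by (simp add: data_filter_eq_Nil_iff)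

text \<open>Turns membership into a bounded search for an equal element, a form to which the closure
  rules apply.\<close>

lemma mem_data_elems_iff: "a \<in> data_elems l \<longleftrightarrow> (\<exists>e\<in>data_elems l. e = a)"
  by simp

lemma polytime_computes:
  assumes "polytime f"
  obtains c p where "\<And>w. \<exists>t. computes c w t (f w) \<and> t \<le> poly p (data_size w)"
proof -
  obtain c T where T: "polybound T" and c: "implements c 0 0 1 f T"
    using assms by (rule polytime_implements[of f 0 1 0]) auto
  obtain p where p: "\<And>w. T w \<le> poly p (data_size w)" using T by (auto simp: polybound_def)
  have "\<exists>t. computes c w t (f w) \<and> t \<le> poly p (data_size w)" for w
  proof -
    let ?s = "(\<lambda>_. data.Nil)(0 := w)"
    obtain t s' where "exec c ?s t s'" "t \<le> T w" "s' 0 = f w"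
      using c[unfolded implements_def, rule_format, of ?s] by auto
    then show ?thesis unfolding computes_def using order_trans[OF _ p] by blast
  qed
  then show thesis by (rule that)
qed

lemmas polytime_intros = polytime_id polytime_hd polytime_tl polytime_Cons polytime_const polytime_if
  polytime_filter polytime_eq polytime_not polytime_conj polytime_disj polytime_Bex

section \<open>Separations and vertex covers\<close>

text \<open>The set \<open>V\<close> is a separate argument because the notion is applied both to
  \<open>pverts G\<close> and to the cover \<open>X\<close> alone. In a symmetric graph, excluding
  arcs from \<open>A\<close> to \<open>B\<close> also excludes those from \<open>B\<close> to
  \<open>A\<close>.\<close>

definition separation :: "'a pair_pre_digraph \<Rightarrow> 'a set \<Rightarrow> 'a set \<Rightarrow> 'a set \<Rightarrow> 'a set \<Rightarrow> bool" where
  "separation G V A S B \<longleftrightarrow>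
     V = A \<union> S \<union> B \<and> A \<inter> S = {} \<and> A \<inter> B = {} \<and> S \<inter> B = {} \<and> A \<noteq> {} \<and> B \<noteq> {} \<and>
     (\<forall>u\<in>S. \<forall>v\<in>S. (u, v) \<notin> parcs G) \<and> (\<forall>a\<in>A. \<forall>b\<in>B. (a, b) \<notin> parcs G)"

text \<open>In a symmetric graph a strongly connected component is closed under adjacency, so one of
  two components can serve as \<open>A\<close>. Conversely, a walk that starts in \<open>A\<close>
  never leaves it, so a vertex of \<open>A\<close> and one of its complement lie in different
  components.\<close>

lemma two_le_card_sccs_iff:
  assumes "graph H"
  shows "2 \<le> card (pre_digraph.sccs H) \<longleftrightarrow>
    (\<exists>A. A \<subseteq> verts H \<and> A \<noteq> {} \<and> A \<noteq> verts H \<and> (\<forall>a\<in>A. \<forall>b\<in>verts H - A. \<not> a \<rightarrow>\<^bsub>H\<^esub> b))"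
    (is "?L \<longleftrightarrow> (\<exists>A. ?R A)")
proof -
  interpret graph H by fact
  show ?thesis
  proof
    assume ?L
    then have "2 \<le> card sccs_verts" by (simp add: card_sccs_verts)
    then obtain C D where CD: "C \<in> sccs_verts" "D \<in> sccs_verts" "C \<noteq> D"
      by (metis card_2_iff' obtain_subset_with_card_n subsetD)
    have "C \<noteq> {}" "D \<noteq> {}" using CD by (auto simp: in_sccs_verts_conv_reachable)
    moreover have "C \<subseteq> verts H" "D \<subseteq> verts H" using CD by (auto dest: sccs_verts_subsets)
    moreover have "C \<inter> D = {}" using CD sccs_verts_disjoint by blast
    moreover have "\<not> a \<rightarrow>\<^bsub>H\<^esub> b" if "a \<in> C" "b \<in> verts H - C" for a b
    proof
      assume "a \<rightarrow>\<^bsub>H\<^esub> b"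
      then have "a \<rightarrow>\<^sup>*\<^bsub>H\<^esub> b" by auto
      moreover from this have "b \<rightarrow>\<^sup>*\<^bsub>H\<^esub> a" using symmetric_reachable[OF sym_arcs] by blast
      ultimately show False using that CD(1) by (auto simp: in_sccs_verts_conv_reachable)
    qed
    ultimately have "?R C" by blast
    then show "\<exists>A. ?R A" ..
  next
    assume "\<exists>A. ?R A"
    then obtain A where A: "?R A" ..
    then obtain a b where ab: "a \<in> A" "b \<in> verts H - A" by blast
    have stay: "v \<in> A" if "a \<rightarrow>\<^sup>*\<^bsub>H\<^esub> v" for v
      using that
    proof (induct rule: reachable_induct)
      case base
      then show ?case using ab by simp
    next
      case (step u v)
      then show ?case using A adj_in_verts by blast
    qed
    then have "b \<notin> scc_of a" using ab by (auto simp: scc_of_def)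
    moreover have "b \<in> scc_of b" using ab by (auto intro: in_scc_of_self)
    ultimately have ne: "scc_of a \<noteq> scc_of b" by auto
    have "{scc_of a, scc_of b} \<subseteq> sccs_verts"
      using ab A by (auto intro: scc_of_in_sccs_verts)
    then have "card {scc_of a, scc_of b} \<le> card sccs_verts"
      by (rule card_mono[OF finite_sccs_verts])
    then show ?L using ne by (simp add: card_sccs_verts)
  qed
qed

text \<open>Replaces components by a partition, which can be restricted to a vertex cover and
  extended from it. The sides may be unions of several components.\<close>

lemma has_stable_cutset_iff_separation:
  assumes "pair_graph G"
  shows "has_stable_cutset G \<longleftrightarrow> (\<exists>A S B. separation G (pverts G) A S B)"
proof -
  interpret pair_graph G by fact
  have gr: "graph (with_proj G \<restriction> U)" if "U \<subseteq> pverts G" for U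
  proof -
    have ind: "induced_subgraph (with_proj G \<restriction> U) (with_proj G)"
      using that by (intro induced_induce) simp
    show ?thesis
      using digraphI_induced[OF ind] induced_graph_imp_graph[OF ind]
      by (simp add: graph_def pseudo_graph_def digraph_def)
  qed
  have adj: "u \<rightarrow>\<^bsub>with_proj G \<restriction> U\<^esub> v \<longleftrightarrow> (u, v) \<in> parcs G \<and> u \<in> U \<and> v \<in> U" for u v U
    by (auto simp: arcs_ends_def arc_to_ends_def)
  show ?thesis
  proof
    assume "has_stable_cutset G"
    then obtain S where S: "stable_set G S"
      and two: "2 \<le> card (pre_digraph.sccs (with_proj G \<restriction> (pverts G - S)))"
      by (auto simp: has_stable_cutset_def stable_cutset_def)
    from two obtain A where "A \<subseteq> pverts G - S" "A \<noteq> {}" "A \<noteq> pverts G - S"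
      "\<forall>a\<in>A. \<forall>b\<in>pverts G - S - A. (a, b) \<notin> parcs G"
      by (subst (asm) two_le_card_sccs_iff) (auto simp: gr adj)
    then have "separation G (pverts G) A S (pverts G - S - A)"
      using S by (auto simp: separation_def stable_set_def)
    then show "\<exists>A S B. separation G (pverts G) A S B" by blast
  next
    assume "\<exists>A S B. separation G (pverts G) A S B"
    then obtain A S B where sep: "separation G (pverts G) A S B" by blast
    then have V: "pverts G - S = A \<union> B" by (auto simp: separation_def)
    have "2 \<le> card (pre_digraph.sccs (with_proj G \<restriction> (pverts G - S)))"
      using sep unfolding V
      by (subst two_le_card_sccs_iff)
        (auto intro!: gr exI[of _ A] simp: adj separation_def)
    moreover have "stable_set G S" using sep by (auto simp: separation_def stable_set_def)
    ultimately show "has_stable_cutset G"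
      by (auto simp: has_stable_cutset_def stable_cutset_def)
  qed
qed

lemma stable_neighbourhood_has_stable_cutset:
  assumes "pair_graph G" "3 \<le> card (pverts G)" "v \<in> pverts G"
    and st: "\<And>x y. (v, x) \<in> parcs G \<Longrightarrow> (v, y) \<in> parcs G \<Longrightarrow> (x, y) \<notin> parcs G"
  shows "has_stable_cutset G"
proof -
  interpret pair_graph G by fact
  let ?N = "{x. (v, x) \<in> parcs G}"
  have irr: "(u, u) \<notin> parcs G" for u using pair_no_loops[of "(u, u)"] by auto
  then have N: "?N \<subseteq> pverts G" "v \<notin> ?N" by (auto dest: in_arcsD2)
  show ?thesis
  proof (cases "pverts G = insert v ?N")
    \<comment> \<open>Some vertex is neither \<open>v\<close> nor a neighbour of \<open>v\<close>,
      and \<open>?N\<close> separates \<open>v\<close> from it; this includes an isolated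
      \<open>v\<close>, where \<open>?N\<close> is empty.\<close>
    case False
    then have "separation G (pverts G) {v} ?N (pverts G - insert v ?N)"
      unfolding separation_def using N st assms(3) by (intro conjI; blast)
    then show ?thesis using has_stable_cutset_iff_separation[OF assms(1)] by blast
  next
    \<comment> \<open>\<open>G\<close> is a star with centre \<open>v\<close>. Having at least three
      vertices, it has two distinct leaves, and removing \<open>v\<close> separates them.\<close>
    case True
    have fin: "finite ?N" using N(1) pair_finite_verts by (rule finite_subset)
    with True have "\<not> card ?N \<le> Suc 0" using assms(2) N(2) by simp
    then obtain x y where xy: "x \<in> ?N" "y \<in> ?N" "x \<noteq> y"
      using card_le_Suc0_iff_eq[OF fin] by blast
    then have "separation G (pverts G) {x} {v} (?N - {x})"
      unfolding separation_def using N st True irr by (intro conjI; blast)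
    then show ?thesis using has_stable_cutset_iff_separation[OF assms(1)] by blast
  qed
qed

text \<open>
  A vertex outside \<open>X\<close> can be added to a separation of \<open>X\<close> unless it sees all three parts: it joins
  \<open>S\<close> if it only sees \<open>A\<close> and \<open>B\<close>, and otherwise the side it sees.
\<close>

lemma has_stable_cutset_iff_separation_cover:
  assumes G: "pair_graph G" and X: "vertex_cover G X"
    and tri: "\<And>v. v \<in> pverts G - X \<Longrightarrow>
      \<exists>x y. (v, x) \<in> parcs G \<and> (v, y) \<in> parcs G \<and> (x, y) \<in> parcs G"
  shows "has_stable_cutset G \<longleftrightarrow>
    (\<exists>A S B. separation G X A S B \<and> \<not> (\<exists>a\<in>A. \<exists>s\<in>S. \<exists>b\<in>B. \<exists>v\<in>pverts G - X.
       (v, a) \<in> parcs G \<and> (v, s) \<in> parcs G \<and> (v, b) \<in> parcs G))"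
    (is "_ \<longleftrightarrow> (\<exists>A S B. ?P A S B)")
proof -
  interpret pair_graph G by fact
  have sym: "(v, u) \<in> parcs G" if "(u, v) \<in> parcs G" for u v
    using that by (metis arcs_symmetric)
  have XV: "X \<subseteq> pverts G" and ind: "\<And>u v. u \<in> pverts G - X \<Longrightarrow> v \<in> pverts G - X \<Longrightarrow> (u, v) \<notin> parcs G"
    using X by (auto simp: vertex_cover_def stable_set_def)
  have nb: "x \<in> X" if "v \<in> pverts G - X" "(v, x) \<in> parcs G" for v x
    using that ind[of v x] by (auto dest: in_arcsD2)
  show ?thesis unfolding has_stable_cutset_iff_separation[OF G]
  proof
    assume "\<exists>A S B. separation G (pverts G) A S B"
    then obtain A S B where sep: "separation G (pverts G) A S B" by blast
    have V: "pverts G = A \<union> S \<union> B" and dj: "A \<inter> S = {}" "A \<inter> B = {}" "S \<inter> B = {}"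
      and S: "\<And>u v. u \<in> S \<Longrightarrow> v \<in> S \<Longrightarrow> (u, v) \<notin> parcs G"
      and AB: "\<And>u v. u \<in> A \<Longrightarrow> v \<in> B \<Longrightarrow> (u, v) \<notin> parcs G"
      using sep unfolding separation_def by blast+
    have BA: "(u, v) \<notin> parcs G" if "u \<in> B" "v \<in> A" for u v
      using AB that sym by blast
    \<comment> \<open>A vertex of \<open>C\<close> outside \<open>X\<close> has its two triangle
      partners in \<open>X\<close>. If \<open>C\<close> misses \<open>X\<close>, both partners must
      lie in \<open>S\<close>, yet they are adjacent.\<close>
    have meet: "C \<inter> X \<noteq> {}"
      if ne: "C \<noteq> {}" and CV: "C \<subseteq> pverts G" and cl: "\<And>u v. u \<in> C \<Longrightarrow> (u, v) \<in> parcs G \<Longrightarrow> v \<in> C \<union> S" for C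
    proof
      assume CX: "C \<inter> X = {}"
      obtain c where c: "c \<in> C" using ne by blast
      with CX CV have cX: "c \<in> pverts G - X" by blast
      then obtain x y where xy: "(c, x) \<in> parcs G" "(c, y) \<in> parcs G" "(x, y) \<in> parcs G"
        using tri by blast
      then have "x \<in> X" "y \<in> X" using nb cX by blast+
      with xy CX cl[OF c] have "x \<in> S" "y \<in> S" by blast+
      with S xy(3) show False by blast
    qed
    have "A \<inter> X \<noteq> {}"
    proof (rule meet)
      show "v \<in> A \<union> S" if "u \<in> A" "(u, v) \<in> parcs G" for u v
        using AB[of u v] that V in_arcsD2[of u v] by auto
    qed (use sep V in \<open>auto simp: separation_def\<close>)
    moreover have "B \<inter> X \<noteq> {}"
    proof (rule meet)
      show "v \<in> B \<union> S" if "u \<in> B" "(u, v) \<in> parcs G" for u v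
        using BA[of u v] that V in_arcsD2[of u v] by auto
    qed (use sep V in \<open>auto simp: separation_def\<close>)
    ultimately have "separation G X (A \<inter> X) (S \<inter> X) (B \<inter> X)"
      using V XV dj S AB by (auto simp: separation_def)
    \<comment> \<open>\<open>v\<close> belongs to one of the three parts, and there one of its
      neighbours is forbidden: \<open>b\<close> if \<open>v\<close> is in \<open>A\<close>,
      \<open>s\<close> if it is in \<open>S\<close>, \<open>a\<close> if it is in
      \<open>B\<close>.\<close>
    moreover have False
      if "a \<in> A" "s \<in> S" "b \<in> B" "v \<in> pverts G" "(v, a) \<in> parcs G" "(v, s) \<in> parcs G" "(v, b) \<in> parcs G"
      for a s b v
      using that V AB[of v b] BA[of v a] S[of v s] by auto
    ultimately have "?P (A \<inter> X) (S \<inter> X) (B \<inter> X)" by blast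
    then show "\<exists>A S B. ?P A S B" by blast
  next
    assume "\<exists>A S B. ?P A S B"
    then obtain A S B where P: "?P A S B" by blast
    then have V: "X = A \<union> S \<union> B" and dj: "A \<inter> S = {}" "A \<inter> B = {}" "S \<inter> B = {}"
      and ne: "A \<noteq> {}" "B \<noteq> {}"
      and S: "\<And>u v. u \<in> S \<Longrightarrow> v \<in> S \<Longrightarrow> (u, v) \<notin> parcs G"
      and AB: "\<And>u v. u \<in> A \<Longrightarrow> v \<in> B \<Longrightarrow> (u, v) \<notin> parcs G"
      and no: "\<And>v a s b. v \<in> pverts G - X \<Longrightarrow> a \<in> A \<Longrightarrow> s \<in> S \<Longrightarrow> b \<in> B \<Longrightarrow>
        (v, a) \<in> parcs G \<Longrightarrow> (v, s) \<in> parcs G \<Longrightarrow> (v, b) \<in> parcs G \<Longrightarrow> False"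
      unfolding separation_def by blast+
    define sees where "sees v C \<longleftrightarrow> (\<exists>c\<in>C. (v, c) \<in> parcs G)" for v C
    let ?I = "pverts G - X"
    let ?S = "{v\<in>?I. sees v A \<and> sees v B}"
    \<comment> \<open>Vertices that see neither side are put on the side of \<open>A\<close> by
      convention.\<close>
    let ?A = "{v\<in>?I. \<not> sees v B}"
    let ?B = "{v\<in>?I. sees v B \<and> \<not> sees v A}"
    have "(u, v) \<notin> parcs G" if "u \<in> S \<union> ?S" "v \<in> S \<union> ?S" for u v
    proof -
      \<comment> \<open>A vertex of \<open>?S\<close> sees both \<open>A\<close> and
        \<open>B\<close>, so a neighbour in \<open>S\<close> would complete a triple excluded by
        \<open>no\<close>.\<close>
      have "(s, v) \<notin> parcs G" "(v, s) \<notin> parcs G" if "s \<in> S" "v \<in> ?S" for s v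
        using that no[of v _ s] sym[of s v] unfolding sees_def by blast+
      then show ?thesis using that S[of u v] ind[of u v] by blast
    qed
    moreover have "(u, v) \<notin> parcs G" if "u \<in> A \<union> ?A" "v \<in> B \<union> ?B" for u v
      using that AB[of u v] ind[of u v] sym[of u v] unfolding sees_def by blast
    moreover have "pverts G = (A \<union> ?A) \<union> (S \<union> ?S) \<union> (B \<union> ?B)" using V XV by blast
    moreover have "(A \<union> ?A) \<inter> (S \<union> ?S) = {}" "(A \<union> ?A) \<inter> (B \<union> ?B) = {}" "(S \<union> ?S) \<inter> (B \<union> ?B) = {}"
      using V dj by blast+
    ultimately have "separation G (pverts G) (A \<union> ?A) (S \<union> ?S) (B \<union> ?B)"
      using ne unfolding separation_def by (intro conjI ballI; blast)
    then show "\<exists>A S B. separation G (pverts G) A S B" by blast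
  qed
qed

section \<open>Induced subgraphs that contain the cover\<close>

definition restrict_graph :: "'a pair_pre_digraph \<Rightarrow> 'a set \<Rightarrow> 'a pair_pre_digraph" where
  "restrict_graph G V = \<lparr>pverts = V, parcs = {(u, v) \<in> parcs G. u \<in> V \<and> v \<in> V}\<rparr>"

lemma restrict_graph_simps [simp]:
  "pverts (restrict_graph G V) = V"
  "(u, v) \<in> parcs (restrict_graph G V) \<longleftrightarrow> (u, v) \<in> parcs G \<and> u \<in> V \<and> v \<in> V"
  by (auto simp: restrict_graph_def)

lemma pair_graph_restrict_graph:
  assumes "pair_graph G" "V \<subseteq> pverts G"
  shows "pair_graph (restrict_graph G V)"
proof -
  interpret pair_graph G by fact
  have fin: "finite V" using assms(2) pair_finite_verts by (rule finite_subset)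
  show ?thesis
  proof
    show "finite (pverts (restrict_graph G V))" using fin by simp
    show "finite (parcs (restrict_graph G V))"
      by (rule finite_subset[of _ "V \<times> V"]) (auto simp: restrict_graph_def fin)
    show "symmetric (with_proj (restrict_graph G V))"
      using arcs_symmetric by (auto simp: symmetric_def sym_def restrict_graph_def)
  qed (use pair_no_loops in \<open>auto simp: restrict_graph_def\<close>)
qed

lemma vertex_cover_restrict_graph:
  assumes "vertex_cover G X" "X \<subseteq> V" "V \<subseteq> pverts G"
  shows "vertex_cover (restrict_graph G V) X"
  using assms unfolding vertex_cover_def stable_set_def restrict_graph_simps by blast

text \<open>Both graphs satisfy the criterion in terms of separations of \<open>X\<close>, since the
  triangles use two vertices of \<open>X\<close> and survive the restriction. Arcs within
  \<open>X\<close> are unchanged, and every triple blocked in \<open>G\<close> stays blocked through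
  the vertex supplied by \<open>rep\<close>.\<close>

lemma has_stable_cutset_restrict_graph_iff:
  assumes G: "pair_graph G" and X: "vertex_cover G X" and V: "X \<subseteq> V" "V \<subseteq> pverts G"
    and tri: "\<And>v. v \<in> pverts G - X \<Longrightarrow>
      \<exists>x\<in>X. \<exists>y\<in>X. (v, x) \<in> parcs G \<and> (v, y) \<in> parcs G \<and> (x, y) \<in> parcs G"
    and rep: "\<And>x y z v. x \<in> X \<Longrightarrow> y \<in> X \<Longrightarrow> z \<in> X \<Longrightarrow> v \<in> pverts G - X \<Longrightarrow>
      (v, x) \<in> parcs G \<Longrightarrow> (v, y) \<in> parcs G \<Longrightarrow> (v, z) \<in> parcs G \<Longrightarrow>
      \<exists>u\<in>V - X. (u, x) \<in> parcs G \<and> (u, y) \<in> parcs G \<and> (u, z) \<in> parcs G"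
  shows "has_stable_cutset (restrict_graph G V) \<longleftrightarrow> has_stable_cutset G"
proof -
  let ?H = "restrict_graph G V"
  let ?blocked = "\<lambda>G A S B. \<exists>a\<in>A. \<exists>s\<in>S. \<exists>b\<in>B. \<exists>v\<in>pverts G - X.
    (v, a) \<in> parcs G \<and> (v, s) \<in> parcs G \<and> (v, b) \<in> parcs G"
  have H: "pair_graph ?H" "vertex_cover ?H X"
    using pair_graph_restrict_graph[OF G V(2)] vertex_cover_restrict_graph[OF X V] by auto
  have triH: "\<exists>x y. (v, x) \<in> parcs ?H \<and> (v, y) \<in> parcs ?H \<and> (x, y) \<in> parcs ?H"
    if "v \<in> pverts ?H - X" for v
    using tri[of v] that V by auto
  have triG: "\<exists>x y. (v, x) \<in> parcs G \<and> (v, y) \<in> parcs G \<and> (x, y) \<in> parcs G"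
    if "v \<in> pverts G - X" for v
    using tri[OF that] by blast
  have sep: "separation ?H X A S B \<longleftrightarrow> separation G X A S B" for A S B
    using V(1) unfolding separation_def restrict_graph_simps by (intro conj_cong refl) blast+
  have blocked: "?blocked ?H A S B \<longleftrightarrow> ?blocked G A S B" if "separation G X A S B" for A S B
  proof
    assume "?blocked ?H A S B"
    then show "?blocked G A S B" using V(2) unfolding restrict_graph_simps by blast
  next
    assume "?blocked G A S B"
    then obtain a s b v where "a \<in> A" "s \<in> S" "b \<in> B" "v \<in> pverts G - X"
      "(v, a) \<in> parcs G" "(v, s) \<in> parcs G" "(v, b) \<in> parcs G" by blast
    moreover have "A \<subseteq> X" "S \<subseteq> X" "B \<subseteq> X" using that by (auto simp: separation_def)
    ultimately obtain u where "u \<in> V - X" "(u, a) \<in> parcs G" "(u, s) \<in> parcs G" "(u, b) \<in> parcs G"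
      "a \<in> V" "s \<in> V" "b \<in> V"
      using rep[of a s b v] V(1) by blast
    then show "?blocked ?H A S B" using \<open>a \<in> A\<close> \<open>s \<in> S\<close> \<open>b \<in> B\<close> by auto
  qed
  have "has_stable_cutset ?H \<longleftrightarrow> (\<exists>A S B. separation ?H X A S B \<and> \<not> ?blocked ?H A S B)"
    using H triH by (rule has_stable_cutset_iff_separation_cover)
  also have "\<dots> \<longleftrightarrow> (\<exists>A S B. separation G X A S B \<and> \<not> ?blocked G A S B)"
    unfolding sep by (intro ex_cong1 conj_cong refl arg_cong[of _ _ Not] blocked)
  also have "\<dots> \<longleftrightarrow> has_stable_cutset G"
    using G X triG by (rule has_stable_cutset_iff_separation_cover[symmetric])
  finally show ?thesis .
qed

section \<open>The kernelization\<close>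

text \<open>An encoded edge list contains each edge in one orientation only, so both are looked
  up.\<close>

definition adjacent :: "data \<Rightarrow> data \<Rightarrow> data \<Rightarrow> bool" where
  "adjacent es u v \<longleftrightarrow> data.Cons u v \<in> data_elems es \<or> data.Cons v u \<in> data_elems es"

definition outer_neighbour :: "data \<Rightarrow> data \<Rightarrow> data \<Rightarrow> data \<Rightarrow> data \<Rightarrow> data \<Rightarrow> bool" where
  "outer_neighbour es xs x y z v \<longleftrightarrow>
     v \<notin> data_elems xs \<and> adjacent es v x \<and> adjacent es v y \<and> adjacent es v z"

text \<open>
  The head of the filtered list represents the triple.  The first conjunct excludes triples without
  a common neighbour: the head of the empty list is nil, which encodes the vertex \<open>0\<close>.
\<close>

definition kept :: "data \<Rightarrow> data \<Rightarrow> data \<Rightarrow> data \<Rightarrow> bool" where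
  "kept vs es xs v \<longleftrightarrow> v \<in> data_elems xs \<or>
     (\<exists>x\<in>data_elems xs. \<exists>y\<in>data_elems xs. \<exists>z\<in>data_elems xs. outer_neighbour es xs x y z v \<and>
        data_hd (data_filter (\<lambda>u. outer_neighbour es xs x y z u) vs data.Nil) = v)"

text \<open>Looking for \<open>x\<close> and \<open>y\<close> in \<open>xs\<close> suffices: if
  \<open>xs\<close> lists a vertex cover, all neighbours of an outer vertex belong to it.\<close>

definition stable_outer_neighbourhood :: "data \<Rightarrow> data \<Rightarrow> data \<Rightarrow> bool" where
  "stable_outer_neighbourhood vs es xs \<longleftrightarrow>
     (\<exists>v\<in>data_elems vs. v \<notin> data_elems xs \<and>
        \<not> (\<exists>x\<in>data_elems xs. \<exists>y\<in>data_elems xs. adjacent es v x \<and> adjacent es v y \<and> adjacent es x y))"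

text \<open>Two isolated vertices with no edges and an empty cover; the empty set is a stable
  cutset.\<close>

definition yes_instance :: data where
  "yes_instance = data.Cons (encode_list encode_nat [0, 1]) (data.Cons data.Nil data.Nil)"

text \<open>The first test singles out graphs with at most two vertices. They already have constant
  size, and a stable neighbourhood need not yield a cutset there, as a single edge shows.\<close>

definition kernel :: "data \<Rightarrow> data \<Rightarrow> data \<Rightarrow> data" where
  "kernel vs es xs =
     (if data_tl (data_tl vs) = data.Nil then data.Cons vs (data.Cons es xs)
      else if stable_outer_neighbourhood vs es xs then yes_instance
      else data.Cons (data_filter (\<lambda>v. kept vs es xs v) vs data.Nil)
        (data.Cons (data_filter (\<lambda>e. kept vs es xs (data_hd e) \<and> kept vs es xs (data_tl e)) es data.Nil)
           xs))"

text \<open>Unfolding leaves a fixed nesting of filters, bounded searches, equality tests and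
  connectives, so the closure rules apply along the structure of the term.\<close>

lemma polytime_kernel: "polytime (\<lambda>w. kernel (data_hd w) (data_hd (data_tl w)) (data_tl (data_tl w)))"
  unfolding kernel_def stable_outer_neighbourhood_def kept_def outer_neighbour_def adjacent_def
    mem_data_elems_iff
  by (intro polytime_intros)

section \<open>The kernel on encoded instances\<close>

lemma data_elems_encode_list [simp]: "data_elems (encode_list f l) = f ` set l"
  by (induction l) auto

lemma data_filter_encode_list_acc:
  "data_filter P (encode_list f l) (encode_list f acc) =
    encode_list f (rev (filter (\<lambda>a. P (f a)) l) @ acc)"
proof (induction l arbitrary: acc)
  case (Cons a l)
  show ?case using Cons.IH[of "a # acc"] Cons.IH[of acc] by simp
qed simp

lemma data_filter_encode_list [simp]:
  "data_filter P (encode_list f l) data.Nil = encode_list f (rev (filter (\<lambda>a. P (f a)) l))"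
  using data_filter_encode_list_acc[of P f l "[]"] by simp

lemma encode_nat_eq_iff [simp]: "encode_nat m = encode_nat n \<longleftrightarrow> m = n"
  using inj_encode_nat by (auto dest: injD)

lemma adjacent_encode_iff:
  "adjacent (encode_list encode_edge es) (encode_nat u) (encode_nat v) \<longleftrightarrow> (u, v) \<in> set es \<union> (set es)\<inverse>"
proof -
  have "data.Cons (encode_nat a) (encode_nat b) \<in> encode_edge ` set es \<longleftrightarrow> (a, b) \<in> set es" for a b
    by (force simp: encode_edge_def image_iff)
  then show ?thesis by (simp add: adjacent_def)
qed

lemma has_stable_cutset_two_isolated:
  "has_stable_cutset \<lparr>pverts = {0, 1 :: nat}, parcs = {}\<rparr>" (is "has_stable_cutset ?G")
  and pair_graph_two_isolated: "pair_graph \<lparr>pverts = {0, 1 :: nat}, parcs = {}\<rparr>"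
proof -
  show G: "pair_graph ?G" by unfold_locales (auto simp: symmetric_def sym_def)
  have "separation ?G (pverts ?G) {0} {} {1}" by (auto simp: separation_def)
  then show "has_stable_cutset ?G" using has_stable_cutset_iff_separation[OF G] by blast
qed

text \<open>The bound 2 is for the small instance returned unchanged and the fixed yes-instance: for
  empty \<open>X\<close> the cubic bound alone would allow no vertex.\<close>

lemma kernel_correct:
  assumes G: "pair_graph G" and X: "vertex_cover G X"
    and vs: "distinct vs" "set vs = pverts G"
    and es: "distinct (map (\<lambda>(u, v). {u, v}) es)" "set es \<union> (set es)\<inverse> = parcs G"
    and xs: "distinct xs" "set xs = X"
  shows "\<exists>H Y. encodes_instance (kernel (encode_list encode_nat vs) (encode_list encode_edge es)
        (encode_list encode_nat xs)) H Y \<and> pair_graph H \<and> vertex_cover H Y \<and>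
      (has_stable_cutset H \<longleftrightarrow> has_stable_cutset G) \<and>
      (card (pverts H) \<le> 2 * card X ^ 3 \<or> card (pverts H) \<le> 2)"
proof -
  interpret pair_graph G by fact
  let ?vs = "encode_list encode_nat vs" and ?es = "encode_list encode_edge es"
    and ?xs = "encode_list encode_nat xs"
  have XV: "X \<subseteq> pverts G" using X by (simp add: vertex_cover_def)
  then have finX: "finite X" using pair_finite_verts by (rule finite_subset)
  have nbX: "x \<in> X" if "v \<in> pverts G - X" "(v, x) \<in> parcs G" for v x
    using that X in_arcsD2[of v x] by (auto simp: vertex_cover_def stable_set_def)
  have adj: "adjacent ?es (encode_nat u) (encode_nat v) \<longleftrightarrow> (u, v) \<in> parcs G" for u v
    by (simp only: adjacent_encode_iff es)
  have inX: "encode_nat v \<in> data_elems ?xs \<longleftrightarrow> v \<in> X" for v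
    using xs(2) by auto
  \<comment> \<open>Lists with fewer than two elements are included because the tail of nil is
    nil.\<close>
  have small: "data_tl (data_tl ?vs) = data.Nil \<longleftrightarrow> length vs \<le> 2"
    by (cases vs rule: remdups_adj.cases) (auto elim: encode_list.elims)
  have card_vs: "length vs = card (pverts G)" using vs distinct_card by metis
  have son: "stable_outer_neighbourhood ?vs ?es ?xs \<longleftrightarrow>
      (\<exists>v\<in>pverts G - X. \<not> (\<exists>x\<in>X. \<exists>y\<in>X. (v, x) \<in> parcs G \<and> (v, y) \<in> parcs G \<and> (x, y) \<in> parcs G))"
    unfolding stable_outer_neighbourhood_def data_elems_encode_list bex_simps adj vs xs
    by auto
  show ?thesis
  proof (cases "length vs \<le> 2")
    case True
    then have "encodes_instance (kernel ?vs ?es ?xs) G X"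
      using vs es xs small by (auto simp: kernel_def encodes_instance_def)
    then show ?thesis using G X True card_vs by auto
  next
    case big: False
    show ?thesis
    proof (cases "stable_outer_neighbourhood ?vs ?es ?xs")
      case True
      then obtain v where v: "v \<in> pverts G - X"
        "\<not> (\<exists>x\<in>X. \<exists>y\<in>X. (v, x) \<in> parcs G \<and> (v, y) \<in> parcs G \<and> (x, y) \<in> parcs G)"
        unfolding son by blast
      \<comment> \<open>All neighbours of \<open>v\<close> lie in \<open>X\<close>, so the absence
        of a triangle with \<open>X\<close> makes its neighbourhood stable; \<open>big\<close> gives
        at least three vertices.\<close>
      then have "has_stable_cutset G"
        using big card_vs nbX[OF v(1)]
        by (intro stable_neighbourhood_has_stable_cutset[OF G, of v]) auto
      moreover have "encodes_instance (kernel ?vs ?es ?xs) \<lparr>pverts = {0, 1}, parcs = {}\<rparr> {}"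
        using big small True unfolding kernel_def encodes_instance_def yes_instance_def
        by (intro exI[of _ "[0, 1]"] exI[of _ "[]"]) auto
      moreover have "vertex_cover \<lparr>pverts = {0, 1 :: nat}, parcs = {}\<rparr> {}"
        by (simp add: vertex_cover_def stable_set_def)
      ultimately show ?thesis
        using has_stable_cutset_two_isolated pair_graph_two_isolated
        by (intro exI[of _ "\<lparr>pverts = {0, 1}, parcs = {}\<rparr>"] exI[of _ "{}"]) auto
    next
      case False
      then have tri: "\<exists>x\<in>X. \<exists>y\<in>X. (v, x) \<in> parcs G \<and> (v, y) \<in> parcs G \<and> (x, y) \<in> parcs G"
        if "v \<in> pverts G - X" for v
        using that unfolding son by blast
      define nb where "nb x y z v \<longleftrightarrow> v \<notin> X \<and> (v, x) \<in> parcs G \<and> (v, y) \<in> parcs G \<and> (v, z) \<in> parcs G"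
        for x y z v
      \<comment> \<open>\<open>data_filter\<close> reverses the order, so the head it yields is the
        last common neighbour in \<open>vs\<close>. Only its dependence on the triple alone
        matters.\<close>
      define rep where "rep x y z = hd (rev (filter (nb x y z) vs))" for x y z
      have outer: "outer_neighbour ?es ?xs (encode_nat x) (encode_nat y) (encode_nat z) (encode_nat v)
          \<longleftrightarrow> nb x y z v" for x y z v
        by (simp only: outer_neighbour_def inX adj nb_def)
      have rep: "rep x y z \<in> set vs \<and> nb x y z (rep x y z) \<and>
          data_hd (encode_list encode_nat (rev (filter (nb x y z) vs))) = encode_nat (rep x y z)"
        if "v \<in> set vs" "nb x y z v" for x y z v
      proof -
        have ne: "rev (filter (nb x y z) vs) \<noteq> []" using that by (auto simp: filter_empty_conv)
        then have "rep x y z \<in> set (rev (filter (nb x y z) vs))"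
          unfolding rep_def by (rule hd_in_set)
        moreover have "data_hd (encode_list encode_nat l) = encode_nat (hd l)" if "l \<noteq> []" for l
          using that by (cases l) auto
        ultimately show ?thesis using ne by (auto simp: rep_def)
      qed
      define V where "V = X \<union> {v \<in> pverts G. \<exists>x\<in>X. \<exists>y\<in>X. \<exists>z\<in>X. nb x y z v \<and> rep x y z = v}"
      have kept: "kept ?vs ?es ?xs (encode_nat v) \<longleftrightarrow> v \<in> V" if "v \<in> pverts G" for v
      proof -
        have "kept ?vs ?es ?xs (encode_nat v) \<longleftrightarrow> v \<in> X \<or> (\<exists>x\<in>X. \<exists>y\<in>X. \<exists>z\<in>X. nb x y z v \<and>
          data_hd (encode_list encode_nat (rev (filter (nb x y z) vs))) = encode_nat v)"
          unfolding kept_def inX data_filter_encode_list by (simp add: outer xs(2))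
        \<comment> \<open>\<open>v\<close> itself is in the filtered list, so the list is nonempty
          and its head is the representative and not the default nil.\<close>
        moreover have "data_hd (encode_list encode_nat (rev (filter (nb x y z) vs))) = encode_nat v
            \<longleftrightarrow> rep x y z = v" if "nb x y z v" for x y z
          using rep[OF _ that] \<open>v \<in> pverts G\<close> vs(2) by simp
        ultimately show ?thesis using that unfolding V_def by blast
      qed
      let ?H = "restrict_graph G V"
      have V: "X \<subseteq> V" "V \<subseteq> pverts G" using XV by (auto simp: V_def)
      have "has_stable_cutset ?H \<longleftrightarrow> has_stable_cutset G"
      proof (rule has_stable_cutset_restrict_graph_iff[OF G X V tri])
        fix x y z v assume "x \<in> X" "y \<in> X" "z \<in> X" and v: "v \<in> pverts G - X"
          "(v, x) \<in> parcs G" "(v, y) \<in> parcs G" "(v, z) \<in> parcs G"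
        then show "\<exists>u\<in>V - X. (u, x) \<in> parcs G \<and> (u, y) \<in> parcs G \<and> (u, z) \<in> parcs G"
          using rep[of v x y z] vs(2) by (intro bexI[of _ "rep x y z"]) (auto simp: nb_def V_def)
      qed
      moreover have "encodes_instance (kernel ?vs ?es ?xs) ?H X"
      proof -
        let ?vs' = "rev (filter (\<lambda>v. v \<in> V) vs)"
          and ?es' = "rev (filter (\<lambda>e. fst e \<in> V \<and> snd e \<in> V) es)"
        have "filter (\<lambda>v. kept ?vs ?es ?xs (encode_nat v)) vs = filter (\<lambda>v. v \<in> V) vs"
          using kept vs(2) by (intro filter_cong) auto
        moreover have "filter (\<lambda>e. kept ?vs ?es ?xs (data_hd (encode_edge e)) \<and>
            kept ?vs ?es ?xs (data_tl (encode_edge e))) es = filter (\<lambda>e. fst e \<in> V \<and> snd e \<in> V) es"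
        proof (intro filter_cong refl)
          fix e assume "e \<in> set es"
          then have "(fst e, snd e) \<in> parcs G" using es(2) by auto
          then have "fst e \<in> pverts G" "snd e \<in> pverts G" by (auto dest: in_arcsD1 in_arcsD2)
          then show "(kept ?vs ?es ?xs (data_hd (encode_edge e)) \<and>
            kept ?vs ?es ?xs (data_tl (encode_edge e))) = (fst e \<in> V \<and> snd e \<in> V)"
            by (simp add: kept encode_edge_def)
        qed
        ultimately have "kernel ?vs ?es ?xs = data.Cons (encode_list encode_nat ?vs')
            (data.Cons (encode_list encode_edge ?es') ?xs)"
          using small big False by (simp add: kernel_def)
        moreover have "distinct ?vs'" "set ?vs' = V" using vs V by auto
        moreover have "distinct (map (\<lambda>(u, v). {u, v}) ?es')"
          using es(1) by (simp add: distinct_map_filter flip: rev_map)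
        moreover have "set ?es' \<union> (set ?es')\<inverse> = parcs ?H"
          unfolding restrict_graph_def using es(2) by auto
        ultimately show ?thesis unfolding encodes_instance_def restrict_graph_simps using xs by blast
      qed
      moreover have "card V \<le> 2 * card X ^ 3"
      proof -
        \<comment> \<open>Every kept vertex outside \<open>X\<close> is the value of
          \<open>rep\<close> at some triple, so there are at most as many as triples.\<close>
        let ?R = "(\<lambda>(x, y, z). rep x y z) ` (X \<times> X \<times> X)"
        have "V \<subseteq> X \<union> ?R" unfolding V_def by force
        then have "card V \<le> card (X \<union> ?R)" by (intro card_mono) (auto simp: finX)
        also have "\<dots> \<le> card X + card ?R" by (rule card_Un_le)
        also have "card ?R \<le> card (X \<times> X \<times> X)" by (rule card_image_le) (simp add: finX)
        also have "\<dots> = card X ^ 3" by (simp add: card_cartesian_product power3_eq_cube)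
        \<comment> \<open>\<open>card X\<close> is at most its cube, also for empty
          \<open>X\<close>; this is where the factor 2 comes from.\<close>
        also have "card X + card X ^ 3 \<le> 2 * card X ^ 3" by (cases "card X") (auto simp: power3_eq_cube)
        finally show ?thesis by simp
      qed
      ultimately show ?thesis
        using pair_graph_restrict_graph[OF G V(2)] vertex_cover_restrict_graph[OF X V]
        by (intro exI[of _ ?H] exI[of _ X]) simp
    qed
  qed
qed

theorem theorem3:
  shows "\<exists>(kernelize :: com) (p :: nat poly) (c :: nat).
    \<forall>(G :: nat pair_pre_digraph) (X :: nat set) (w :: data).
      pair_graph G \<longrightarrow> vertex_cover G X \<longrightarrow> encodes_instance w G X \<longrightarrow>
      (\<exists>(G' :: nat pair_pre_digraph) (X' :: nat set) (w' :: data) (t :: nat).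
         computes kernelize w t w' \<and> t \<le> poly p (data_size w) \<and>
         encodes_instance w' G' X' \<and> pair_graph G' \<and> vertex_cover G' X' \<and>
         (has_stable_cutset G' \<longleftrightarrow> has_stable_cutset G) \<and>
         (card (pverts G') \<le> c * card X ^ 3 \<or> card (pverts G') \<le> c))"
proof -
  obtain c p where c: "\<And>w. \<exists>t. computes c w t (kernel (data_hd w) (data_hd (data_tl w)) (data_tl (data_tl w)))
      \<and> t \<le> poly p (data_size w)"
    using polytime_kernel by (rule polytime_computes) blast
  show ?thesis
  \<comment> \<open>The witness 2 serves both as the factor of the cubic bound and as the size of
    the constant outputs.\<close>
  proof (intro exI[of _ c] exI[of _ p] exI[of _ 2] allI impI)
    fix G :: "nat pair_pre_digraph" and X w
    assume G: "pair_graph G" "vertex_cover G X" and "encodes_instance w G X"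
    then obtain vs es xs where w: "w = data.Cons (encode_list encode_nat vs)
        (data.Cons (encode_list encode_edge es) (encode_list encode_nat xs))"
      and l: "distinct vs" "set vs = pverts G" "distinct (map (\<lambda>(u, v). {u, v}) es)"
        "set es \<union> (set es)\<inverse> = parcs G" "distinct xs" "set xs = X"
      unfolding encodes_instance_def by blast
    show "\<exists>G' X' w' t. computes c w t w' \<and> t \<le> poly p (data_size w) \<and>
         encodes_instance w' G' X' \<and> pair_graph G' \<and> vertex_cover G' X' \<and>
         (has_stable_cutset G' \<longleftrightarrow> has_stable_cutset G) \<and>
         (card (pverts G') \<le> 2 * card X ^ 3 \<or> card (pverts G') \<le> 2)"
      using kernel_correct[OF G l] c[of w] unfolding w data_hd.simps data_tl.simps by blast
  qed
qed

end
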